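(* For every derivation in $\mathsf{SKS}$ with premise $T$ and conclusion $R$ there are structures $V$ and $U$ and a derivation from $T$ to $R$ composed, from top to bottom, of: a derivation from $T$ to $V$ in $\{aw{\uparrow}\}$, a derivation from $V$ to $U$ in $\mathsf{SKS}\setminus\{aw{\downarrow},aw{\uparrow}\}$, and a derivation from $U$ to $R$ in $\{aw{\downarrow}\}$.
   Context: Structures: generated by $S ::= \mathsf f \mid \mathsf t \mid a \mid [S,\dots,S] \mid (S,\dots,S) \mid \bar S$ (non-empty lists), where $a$ ranges over atoms, $\mathsf f,\mathsf t$ are the units false and true, $[\cdot]$ is disjunction, $(\cdot)$ is conjunction, $\bar S$ is negation; the negation of an atom is again an atom. A context $S\{\ \}$ is a structure with one occurrence of a hole, not in the scope of a negation; $S\{R\}$ is the result of filling it with $R$; $S[R,T]$ abbreviates $S\{[R,T]\}$ and $S(R,T)$ abbreviates $S\{(R,T)\}$. Equivalent structures are not distinguished; equivalence is the smallest equivalence relation induced by: $[\vec R,[\vec T],\vec U]=[\vec R,\vec T,\vec U]$ and $(\vec R,(\vec T),\vec U)=(\vec R,\vec T,\vec U)$ (with $\vec R,\vec T,\vec U$ finite sequences, $\vec T$ non-empty); $[R,T]=[T,R]$, $(R,T)=(T,R)$; $(\mathsf f,\mathsf f)=\mathsf f$, $[\mathsf f,R]=R$, $[\mathsf t,\mathsf t]=\mathsf t$, $(\mathsf t,R)=R$; $\bar{\mathsf f}=\mathsf t$, $\bar{\mathsf t}=\mathsf f$, $\overline{[R,T]}=(\bar R,\bar T)$, $\overline{(R,T)}=[\bar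 R,\bar T]$, $\bar{\bar R}=R$; and closure: if $R=T$ then $S\{R\}=S\{T\}$ and $\bar R=\bar T$. A derivation in a system (set of inference rules) is a finite sequence of rule instances, read top-down, the conclusion of each being the premise of the next; it may consist of a single structure. Its premise is the topmost structure, its conclusion the bottommost. System $\mathsf{SKS}$ has the rules (written $\frac{\text{premise}}{\text{conclusion}}$, for atoms $a$, structures $R,T,U,V$ and contexts $S\{\ \}$): $ai{\downarrow}:\frac{S\{\mathsf t\}}{S[a,\bar a]}$, $ai{\uparrow}:\frac{S(a,\bar a)}{S\{\mathsf f\}}$, $s:\frac{S([R,U],T)}{S[(R,T),U]}$, $m:\frac{S[(R,U),(T,V)]}{S([R,T],[U,V])}$, $aw{\downarrow}:\frac{S\{\mathsf f\}}{S\{a\}}$, $aw{\uparrow}:\frac{S\{a\}}{S\{\mathsf t\}}$, $ac{\downarrow}:\frac{S[a,a]}{S\{a\}}$, $ac{\uparrow}:\frac{S\{a\}}{S(a,a)}$. *)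

theory Defs
  imports Main
begin

datatype 'v atom = Pos 'v | Neg 'v

primrec dual :: "'v atom \<Rightarrow> 'v atom" where
  "dual (Pos v) = Neg v"
| "dual (Neg v) = Pos v"

(* Disj and Conj take the head and the tail of the list of their members, so that
   this list is non-empty by construction. *)
datatype 'v strct =
    FF
  | TT
  | Atom "'v atom"
  | Disj "'v strct" "'v strct list"
  | Conj "'v strct" "'v strct list"
  | Bar "'v strct"

(* The structures [Ss] and (Ss) for a list Ss. These are used for non-empty Ss only;
   every occurrence below is visibly non-empty or guarded. *)
definition disjs :: "'v strct list \<Rightarrow> 'v strct" where
  "disjs Ss = Disj (hd Ss) (tl Ss)"

definition conjs :: "'v strct list \<Rightarrow> 'v strct" where
  "conjs Ss = Conj (hd Ss) (tl Ss)"

(* There is no constructor for negation: the hole is not in the scope of a negation. *)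
datatype 'v ctxt =
    Hole
  | DisjC "'v strct list" "'v ctxt" "'v strct list"
  | ConjC "'v strct list" "'v ctxt" "'v strct list"

primrec fill :: "'v ctxt \<Rightarrow> 'v strct \<Rightarrow> 'v strct" where
  "fill Hole X = X"
| "fill (DisjC Ls S Rs) X = disjs (Ls @ [fill S X] @ Rs)"
| "fill (ConjC Ls S Rs) X = conjs (Ls @ [fill S X] @ Rs)"

inductive str_eq :: "'v strct \<Rightarrow> 'v strct \<Rightarrow> bool" (infix "\<approx>" 50) where
  eq_refl: "R \<approx> R"
| eq_sym: "R \<approx> T \<Longrightarrow> T \<approx> R"
| eq_trans: "R \<approx> T \<Longrightarrow> T \<approx> U \<Longrightarrow> R \<approx> U"
| disj_assoc: "Ts \<noteq> [] \<Longrightarrow> disjs (Rs @ [disjs Ts] @ Us) \<approx> disjs (Rs @ Ts @ Us)"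
| conj_assoc: "Ts \<noteq> [] \<Longrightarrow> conjs (Rs @ [conjs Ts] @ Us) \<approx> conjs (Rs @ Ts @ Us)"
| disj_comm: "disjs [R, T] \<approx> disjs [T, R]"
| conj_comm: "conjs [R, T] \<approx> conjs [T, R]"
| conj_ff: "conjs [FF, FF] \<approx> FF"
| disj_ff: "disjs [FF, R] \<approx> R"
| disj_tt: "disjs [TT, TT] \<approx> TT"
| conj_tt: "conjs [TT, R] \<approx> R"
| bar_ff: "Bar FF \<approx> TT"
| bar_tt: "Bar TT \<approx> FF"
(* The negation of an atom is again an atom. *)
| bar_atom: "Bar (Atom a) \<approx> Atom (dual a)"
| bar_disj: "Bar (disjs [R, T]) \<approx> conjs [Bar R, Bar T]"
| bar_conj: "Bar (conjs [R, T]) \<approx> disjs [Bar R, Bar T]"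
| bar_bar: "Bar (Bar R) \<approx> R"
| eq_ctxt: "R \<approx> T \<Longrightarrow> fill S R \<approx> fill S T"
| eq_bar: "R \<approx> T \<Longrightarrow> Bar R \<approx> Bar T"

datatype rule = AiDown | AiUp | Switch | Medial | AwDown | AwUp | AcDown | AcUp

(* scheme r X Y: in a context S, rule r has premise S{X} and conclusion S{Y}. *)
inductive scheme :: "rule \<Rightarrow> 'v strct \<Rightarrow> 'v strct \<Rightarrow> bool" where
  "scheme AiDown TT (disjs [Atom a, Bar (Atom a)])"
| "scheme AiUp (conjs [Atom a, Bar (Atom a)]) FF"
| "scheme Switch (conjs [disjs [R, U], T]) (disjs [conjs [R, T], U])"
| "scheme Medial (disjs [conjs [R, U], conjs [T, V]]) (conjs [disjs [R, T], disjs [U, V]])"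
| "scheme AwDown FF (Atom a)"
| "scheme AwUp (Atom a) TT"
| "scheme AcDown (disjs [Atom a, Atom a]) (Atom a)"
| "scheme AcUp (Atom a) (conjs [Atom a, Atom a])"

(* Equivalent structures are not distinguished, so rule instances are taken modulo \<approx>,
   and a derivation without rule instances leads from T to any R \<approx> T. *)
definition rule_instance :: "rule \<Rightarrow> 'v strct \<Rightarrow> 'v strct \<Rightarrow> bool" where
  "rule_instance r P Q \<longleftrightarrow> (\<exists>S X Y. scheme r X Y \<and> P \<approx> fill S X \<and> Q \<approx> fill S Y)"

(* derivation \<S> T D R: D is a derivation in \<S> with premise T and conclusion R, where D
   lists, from top to bottom, the rules applied together with their conclusions.
   Composition of derivations is concatenation of these lists. *)
fun derivation ::
  "rule set \<Rightarrow> 'v strct \<Rightarrow> (rule \<times> 'v strct) list \<Rightarrow> 'v strct \<Rightarrow> bool" where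
  "derivation \<S> T [] R \<longleftrightarrow> T \<approx> R"
| "derivation \<S> T ((r, Q) # D) R \<longleftrightarrow> r \<in> \<S> \<and> rule_instance r T Q \<and> derivation \<S> Q D R"

definition SKS :: "rule set" where
  "SKS = {AiDown, AiUp, Switch, Medial, AwDown, AwUp, AcDown, AcUp}"

end

theory Submission
  imports Defs
begin

(* Weakenings aw-down are permuted downwards through all other rules, several at a time:
   wk True R' R says that R' arises from R by replacing some atom occurrences by f.
   All equations and the rules s and m are linear, so such a replacement can be
   traced backwards through them. Two interactions are not linear. Where aw-up meets an
   erased atom, f has to become t, which is an instance of s up to equivalence. Where
   ai-up meets an erased atom, (f, b) has to become f without weakening: there f creates
   (f, b) and (f, c), with c the dual of b, by ai-down and s; m and ac-down merge the given
   b with the new one, and m and ai-up then annihilate b against c.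
   Negation turns derivations upside down, so the same result moves aw-up to the top. *)

section \<open>Equivalence of structures\<close>

declare eq_refl [simp, intro] eq_trans [trans]

section \<open>Congruence, one-element lists, and De Morgan laws for lists and contexts\<close>

lemma disjs_ctxt: "R \<approx> T \<Longrightarrow> disjs (Ls @ R # Rs) \<approx> disjs (Ls @ T # Rs)"
  using eq_ctxt[of R T "DisjC Ls Hole Rs"] by simp

lemma conjs_ctxt: "R \<approx> T \<Longrightarrow> conjs (Ls @ R # Rs) \<approx> conjs (Ls @ T # Rs)"
  using eq_ctxt[of R T "ConjC Ls Hole Rs"] by simp

lemma disj_cong: "R \<approx> R' \<Longrightarrow> T \<approx> T' \<Longrightarrow> disjs [R, T] \<approx> disjs [R', T']"
  using disjs_ctxt[of R R' "[]" "[T]"] disjs_ctxt[of T T' "[R']" "[]"]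
  by (auto intro: eq_trans)

lemma conj_cong: "R \<approx> R' \<Longrightarrow> T \<approx> T' \<Longrightarrow> conjs [R, T] \<approx> conjs [R', T']"
  using conjs_ctxt[of R R' "[]" "[T]"] conjs_ctxt[of T T' "[R']" "[]"]
  by (auto intro: eq_trans)

lemma disjs_Cons: "Ss \<noteq> [] \<Longrightarrow> disjs (R # Ss) \<approx> disjs [R, disjs Ss]"
  using disj_assoc[of Ss "[R]" "[]"] by (auto intro: eq_sym)

lemma conjs_Cons: "Ss \<noteq> [] \<Longrightarrow> conjs (R # Ss) \<approx> conjs [R, conjs Ss]"
  using conj_assoc[of Ss "[R]" "[]"] by (auto intro: eq_sym)

text \<open>Associativity only removes brackets inside another list, so the unit \<open>FF\<close>
  is put in front first: \<open>disjs [FF, disjs [R]]\<close> then flattens to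
  \<open>disjs [FF, R]\<close>.\<close>

lemma disjs_single: "disjs [R] \<approx> R"
proof -
  have "disjs [R] \<approx> disjs [FF, disjs [R]]" by (rule eq_sym[OF disj_ff])
  also have "\<dots> \<approx> disjs [FF, R]" by (rule eq_sym[OF disjs_Cons]) simp
  also have "\<dots> \<approx> R" by (rule disj_ff)
  finally show ?thesis .
qed

lemma conjs_single: "conjs [R] \<approx> R"
proof -
  have "conjs [R] \<approx> conjs [TT, conjs [R]]" by (rule eq_sym[OF conj_tt])
  also have "\<dots> \<approx> conjs [TT, R]" by (rule eq_sym[OF conjs_Cons]) simp
  also have "\<dots> \<approx> R" by (rule conj_tt)
  finally show ?thesis .
qed

lemma disj_ff_right: "disjs [R, FF] \<approx> R"
  by (rule eq_trans[OF disj_comm disj_ff])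

lemma disj_assoc2: "disjs [disjs [R, T], U] \<approx> disjs [R, disjs [T, U]]"
  using disj_assoc[of "[R, T]" "[]" "[U]"] disjs_Cons[of "[T, U]" R]
  by (auto intro: eq_trans)

text \<open>The axiom \<open>bar_disj\<close> covers two members; splitting off the head extends it
  to longer lists.\<close>

lemma Bar_disjs: "Ss \<noteq> [] \<Longrightarrow> Bar (disjs Ss) \<approx> conjs (map Bar Ss)"
proof (induction Ss rule: list_nonempty_induct)
  case (single R)
  have "Bar (disjs [R]) \<approx> Bar R" by (rule eq_bar[OF disjs_single])
  also have "\<dots> \<approx> conjs [Bar R]" by (rule eq_sym[OF conjs_single])
  finally show ?case by simp
next
  case (cons R Ss)
  have "Bar (disjs (R # Ss)) \<approx> Bar (disjs [R, disjs Ss])"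
    using cons.hyps by (intro eq_bar disjs_Cons)
  also have "\<dots> \<approx> conjs [Bar R, Bar (disjs Ss)]" by (rule bar_disj)
  also have "\<dots> \<approx> conjs [Bar R, conjs (map Bar Ss)]" using cons.IH by (intro conj_cong) auto
  also have "\<dots> \<approx> conjs (Bar R # map Bar Ss)"
    using cons.hyps by (intro eq_sym[OF conjs_Cons]) auto
  finally show ?case by simp
qed

lemma Bar_conjs: "Ss \<noteq> [] \<Longrightarrow> Bar (conjs Ss) \<approx> disjs (map Bar Ss)"
proof (induction Ss rule: list_nonempty_induct)
  case (single R)
  have "Bar (conjs [R]) \<approx> Bar R" by (rule eq_bar[OF conjs_single])
  also have "\<dots> \<approx> disjs [Bar R]" by (rule eq_sym[OF disjs_single])
  finally show ?case by simp
next
  case (cons R Ss)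
  have "Bar (conjs (R # Ss)) \<approx> Bar (conjs [R, conjs Ss])"
    using cons.hyps by (intro eq_bar conjs_Cons)
  also have "\<dots> \<approx> disjs [Bar R, Bar (conjs Ss)]" by (rule bar_conj)
  also have "\<dots> \<approx> disjs [Bar R, disjs (map Bar Ss)]" using cons.IH by (intro disj_cong) auto
  also have "\<dots> \<approx> disjs (Bar R # map Bar Ss)"
    using cons.hyps by (intro eq_sym[OF disjs_Cons]) auto
  finally show ?case by simp
qed

text \<open>The composed context is chosen before \<open>X\<close>, so the same one serves the
  premise and the conclusion of a rule instance.\<close>

lemma fill_fill: "\<exists>S''. \<forall>X. fill S (fill S' X) = fill S'' X"
proof (induction S)
  case Hole
  show ?case by auto
next
  case (DisjC Ls S Rs)
  then obtain S'' where "\<forall>X. fill S (fill S' X) = fill S'' X" by blast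
  then show ?case by (intro exI[of _ "DisjC Ls S'' Rs"]) simp
next
  case (ConjC Ls S Rs)
  then obtain S'' where "\<forall>X. fill S (fill S' X) = fill S'' X" by blast
  then show ?case by (intro exI[of _ "ConjC Ls S'' Rs"]) simp
qed

text \<open>A hole may not lie under a negation. The De Morgan laws push \<open>Bar\<close> inwards
  along the path to the hole, negating the members beside it on the way.\<close>

lemma Bar_fill: "\<exists>S'. \<forall>X. Bar (fill S X) \<approx> fill S' (Bar X)"
proof (induction S)
  case Hole
  show ?case by (rule exI[of _ Hole]) simp
next
  case (DisjC Ls S Rs)
  then obtain S' where S': "\<And>X. Bar (fill S X) \<approx> fill S' (Bar X)" by blast
  have "Bar (fill (DisjC Ls S Rs) X) \<approx> fill (ConjC (map Bar Ls) S' (map Bar Rs)) (Bar X)" for X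
    using eq_trans[OF Bar_disjs[of "Ls @ [fill S X] @ Rs"]] conjs_ctxt[OF S'] by simp
  then show ?case by blast
next
  case (ConjC Ls S Rs)
  then obtain S' where S': "\<And>X. Bar (fill S X) \<approx> fill S' (Bar X)" by blast
  have "Bar (fill (ConjC Ls S Rs) X) \<approx> fill (DisjC (map Bar Ls) S' (map Bar Rs)) (Bar X)" for X
    using eq_trans[OF Bar_conjs[of "Ls @ [fill S X] @ Rs"]] disjs_ctxt[OF S'] by simp
  then show ?case by blast
qed

section \<open>Derivability\<close>

text \<open>Hides the list of instances, so that derivations chain by transitivity; explicit lists
  return only in the final theorem.\<close>

definition derivable :: "rule set \<Rightarrow> 'v strct \<Rightarrow> 'v strct \<Rightarrow> bool" where
  "derivable \<S> T R \<longleftrightarrow> (\<exists>D. derivation \<S> T D R)"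

section \<open>Derivability as a preorder closed under contexts\<close>

lemma rule_instance_cong:
  "rule_instance r P Q \<Longrightarrow> P' \<approx> P \<Longrightarrow> Q' \<approx> Q \<Longrightarrow> rule_instance r P' Q'"
  unfolding rule_instance_def by (blast intro: eq_trans)

text \<open>Rule instances are taken modulo \<approx>, so the premise can be exchanged. This lets
  two derivations be joined where the upper one ends in an empty list, that is, in a mere
  equivalence.\<close>

lemma derivation_cong_left: "T' \<approx> T \<Longrightarrow> derivation \<S> T D R \<Longrightarrow> derivation \<S> T' D R"
  by (cases "(\<S>, T, D, R)" rule: derivation.cases)
     (auto intro: eq_trans rule_instance_cong)

lemma derivation_append:
  "derivation \<S> T D U \<Longrightarrow> derivation \<S> U E R \<Longrightarrow> derivation \<S> T (D @ E) R"
  by (induction \<S> T D U rule: derivation.induct) (auto intro: derivation_cong_left)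

lemma derivation_mono: "derivation \<S> T D R \<Longrightarrow> \<S> \<subseteq> \<S>' \<Longrightarrow> derivation \<S>' T D R"
  by (induction \<S> T D R rule: derivation.induct) auto

lemma derivable_eq: "T \<approx> R \<Longrightarrow> derivable \<S> T R"
  unfolding derivable_def by (rule exI[of _ "[]"]) simp

lemma derivable_trans [trans]: "derivable \<S> T U \<Longrightarrow> derivable \<S> U R \<Longrightarrow> derivable \<S> T R"
  unfolding derivable_def by (blast intro: derivation_append)

lemma derivable_eq_trans [trans]: "derivable \<S> T U \<Longrightarrow> U \<approx> R \<Longrightarrow> derivable \<S> T R"
  by (blast intro: derivable_eq derivable_trans)

lemma eq_derivable_trans [trans]: "T \<approx> U \<Longrightarrow> derivable \<S> U R \<Longrightarrow> derivable \<S> T R"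
  by (blast intro: derivable_eq derivable_trans)

lemma derivable_rule: "rule_instance r T R \<Longrightarrow> r \<in> \<S> \<Longrightarrow> derivable \<S> T R"
  unfolding derivable_def by (rule exI[of _ "[(r, R)]"]) simp

lemma derivable_scheme: "scheme r X Y \<Longrightarrow> r \<in> \<S> \<Longrightarrow> derivable \<S> X Y"
  by (rule derivable_rule[of r]) (metis rule_instance_def fill.simps(1) eq_refl)

lemma rule_instance_ctxt:
  assumes "rule_instance r P Q"
  shows "rule_instance r (fill S P) (fill S Q)"
proof -
  obtain S' X Y where *: "scheme r X Y" "P \<approx> fill S' X" "Q \<approx> fill S' Y"
    using assms unfolding rule_instance_def by blast
  obtain S'' where "\<forall>X. fill S (fill S' X) = fill S'' X"
    using fill_fill by blast
  then show ?thesis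
    unfolding rule_instance_def using * eq_ctxt by metis
qed

lemma derivable_ctxt:
  assumes "derivable \<S> T R"
  shows "derivable \<S> (fill S T) (fill S R)"
proof -
  have "derivation \<S> T D R \<Longrightarrow> derivable \<S> (fill S T) (fill S R)" for D
    by (induction \<S> T D R rule: derivation.induct)
       (auto intro: derivable_eq eq_ctxt derivable_trans derivable_rule rule_instance_ctxt)
  with assms show ?thesis unfolding derivable_def by blast
qed

lemma derivable_disjs_ctxt:
  "derivable \<S> T R \<Longrightarrow> derivable \<S> (disjs (Ls @ T # Rs)) (disjs (Ls @ R # Rs))"
  using derivable_ctxt[of \<S> T R "DisjC Ls Hole Rs"] by simp

lemma derivable_conjs_ctxt:
  "derivable \<S> T R \<Longrightarrow> derivable \<S> (conjs (Ls @ T # Rs)) (conjs (Ls @ R # Rs))"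
  using derivable_ctxt[of \<S> T R "ConjC Ls Hole Rs"] by simp

lemma derivable_disj:
  "derivable \<S> R R' \<Longrightarrow> derivable \<S> T T' \<Longrightarrow> derivable \<S> (disjs [R, T]) (disjs [R', T'])"
  using derivable_disjs_ctxt[of \<S> R R' "[]" "[T]"] derivable_disjs_ctxt[of \<S> T T' "[R']" "[]"]
  by (auto intro: derivable_trans)

lemma derivable_conj:
  "derivable \<S> R R' \<Longrightarrow> derivable \<S> T T' \<Longrightarrow> derivable \<S> (conjs [R, T]) (conjs [R', T'])"
  using derivable_conjs_ctxt[of \<S> R R' "[]" "[T]"] derivable_conjs_ctxt[of \<S> T T' "[R']" "[]"]
  by (auto intro: derivable_trans)

text \<open>Members are rewritten one after another; the prefix \<open>Ls\<close> collects those
  already done.\<close>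

lemma derivable_disjs:
  "list_all2 (derivable \<S>) Ts Rs \<Longrightarrow> derivable \<S> (disjs (Ls @ Ts)) (disjs (Ls @ Rs))"
proof (induction arbitrary: Ls rule: list_all2_induct)
  case Nil
  show ?case by (simp add: derivable_eq)
next
  case (Cons T Ts R Rs)
  have "derivable \<S> (disjs (Ls @ T # Ts)) (disjs (Ls @ R # Ts))"
    using Cons.hyps(1) by (rule derivable_disjs_ctxt)
  also have "derivable \<S> \<dots> (disjs (Ls @ R # Rs))" using Cons.IH[of "Ls @ [R]"] by simp
  finally show ?case .
qed

lemma derivable_conjs:
  "list_all2 (derivable \<S>) Ts Rs \<Longrightarrow> derivable \<S> (conjs (Ls @ Ts)) (conjs (Ls @ Rs))"
proof (induction arbitrary: Ls rule: list_all2_induct)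
  case Nil
  show ?case by (simp add: derivable_eq)
next
  case (Cons T Ts R Rs)
  have "derivable \<S> (conjs (Ls @ T # Ts)) (conjs (Ls @ R # Ts))"
    using Cons.hyps(1) by (rule derivable_conjs_ctxt)
  also have "derivable \<S> \<dots> (conjs (Ls @ R # Rs))" using Cons.IH[of "Ls @ [R]"] by simp
  finally show ?case .
qed

section \<open>Duality\<close>

primrec dual_rule :: "rule \<Rightarrow> rule" where
  "dual_rule AiDown = AiUp"
| "dual_rule AiUp = AiDown"
| "dual_rule Switch = Switch"
| "dual_rule Medial = Medial"
| "dual_rule AwDown = AwUp"
| "dual_rule AwUp = AwDown"
| "dual_rule AcDown = AcUp"
| "dual_rule AcUp = AcDown"

lemma Bar_disj_disj:
  "Bar (disjs [conjs [R, U], conjs [T, V]])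
     \<approx> conjs [disjs [Bar R, Bar U], disjs [Bar T, Bar V]]"
  by (rule eq_trans[OF bar_disj conj_cong[OF bar_conj bar_conj]])

lemma Bar_conj_conj:
  "Bar (conjs [disjs [R, U], disjs [T, V]])
     \<approx> disjs [conjs [Bar R, Bar U], conjs [Bar T, Bar V]]"
  by (rule eq_trans[OF bar_conj disj_cong[OF bar_disj bar_disj]])

text \<open>Negation exchanges the units, the two connectives, and premise with conclusion.
  \<open>X'\<close> and \<open>Y'\<close> are there because the negated sides match the dual scheme
  only up to \<approx>.\<close>

lemma scheme_dual:
  "scheme r X Y \<Longrightarrow> \<exists>X' Y'. scheme (dual_rule r) Y' X' \<and> Bar X \<approx> X' \<and> Bar Y \<approx> Y'"
proof (induction rule: scheme.induct)
  case (1 a)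
  show ?case
    using scheme.intros(2)[of "dual a"] bar_tt
      eq_trans[OF bar_disj conj_cong[OF bar_atom eq_bar[OF bar_atom]]] by fastforce
next
  case (2 a)
  show ?case
    using scheme.intros(1)[of "dual a"] bar_ff
      eq_trans[OF bar_conj disj_cong[OF bar_atom eq_bar[OF bar_atom]]] by fastforce
next
  \<comment> \<open>Switch, and likewise medial below, is self-dual once \<open>U\<close> and
    \<open>T\<close> exchange roles.\<close>
  case (3 R U T)
  show ?case
    using scheme.intros(3)[of "Bar R" "Bar T" "Bar U"]
      eq_trans[OF bar_disj conj_cong[OF bar_conj eq_refl]]
      eq_trans[OF bar_conj disj_cong[OF bar_disj eq_refl]] by fastforce
next
  case (4 R U T V)
  show ?case
    using scheme.intros(4)[of "Bar R" "Bar T" "Bar U" "Bar V"] Bar_disj_disj Bar_conj_conj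
    by fastforce
next
  case (5 a)
  show ?case using scheme.intros(6)[of "dual a"] bar_atom bar_ff by fastforce
next
  case (6 a)
  show ?case using scheme.intros(5)[of "dual a"] bar_atom bar_tt by fastforce
next
  case (7 a)
  show ?case
    using scheme.intros(8)[of "dual a"] bar_atom
      eq_trans[OF bar_disj conj_cong[OF bar_atom bar_atom]] by fastforce
next
  case (8 a)
  show ?case
    using scheme.intros(7)[of "dual a"] bar_atom
      eq_trans[OF bar_conj disj_cong[OF bar_atom bar_atom]] by fastforce
qed

lemma rule_instance_dual:
  assumes "rule_instance r P Q"
  shows "rule_instance (dual_rule r) (Bar Q) (Bar P)"
proof -
  obtain S X Y where *: "scheme r X Y" "P \<approx> fill S X" "Q \<approx> fill S Y"
    using assms unfolding rule_instance_def by blast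
  obtain S' where S': "\<And>X. Bar (fill S X) \<approx> fill S' (Bar X)"
    using Bar_fill by blast
  obtain X' Y' where "scheme (dual_rule r) Y' X'" and X': "Bar X \<approx> X'" and Y': "Bar Y \<approx> Y'"
    using scheme_dual[OF *(1)] by blast
  moreover have "Bar P \<approx> fill S' X'"
    by (rule eq_trans[OF eq_trans[OF eq_bar[OF *(2)] S'] eq_ctxt[OF X']])
  moreover have "Bar Q \<approx> fill S' Y'"
    by (rule eq_trans[OF eq_trans[OF eq_bar[OF *(3)] S'] eq_ctxt[OF Y']])
  ultimately show ?thesis unfolding rule_instance_def by blast
qed

lemma derivable_dual:
  assumes "derivable \<S> T R"
  shows "derivable (dual_rule ` \<S>) (Bar R) (Bar T)"
proof -
  have "derivation \<S> T D R \<Longrightarrow> derivable (dual_rule ` \<S>) (Bar R) (Bar T)" for D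
    by (induction \<S> T D R rule: derivation.induct)
       (auto intro: derivable_eq eq_bar eq_sym
          derivable_trans[OF _ derivable_rule[OF rule_instance_dual]])
  with assms show ?thesis unfolding derivable_def by blast
qed

section \<open>Erasing atoms\<close>

text \<open>The first argument is the polarity: under an odd number of negations an erased atom
  becomes \<^const>\<open>TT\<close> instead of \<^const>\<open>FF\<close>.\<close>

inductive wk :: "bool \<Rightarrow> 'v strct \<Rightarrow> 'v strct \<Rightarrow> bool" where
  wk_FF: "wk p FF FF"
| wk_TT: "wk p TT TT"
| wk_Atom: "wk p (Atom a) (Atom a)"
| wk_erase: "wk p (if p then FF else TT) (Atom a)"
| wk_Disj: "wk p R' R \<Longrightarrow> list_all2 (wk p) Rs' Rs \<Longrightarrow> wk p (Disj R' Rs') (Disj R Rs)"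
| wk_Conj: "wk p R' R \<Longrightarrow> list_all2 (wk p) Rs' Rs \<Longrightarrow> wk p (Conj R' Rs') (Conj R Rs)"
| wk_Bar: "wk (\<not> p) R' R \<Longrightarrow> wk p (Bar R') (Bar R)"

section \<open>Inversion of the erasure relation\<close>

lemma wk_FF_iff [simp]: "wk p X FF \<longleftrightarrow> X = FF"
  by (auto elim: wk.cases intro: wk_FF)

lemma wk_TT_iff [simp]: "wk p X TT \<longleftrightarrow> X = TT"
  by (auto elim: wk.cases intro: wk_TT)

lemma wk_Atom_iff: "wk p X (Atom a) \<longleftrightarrow> X = Atom a \<or> X = (if p then FF else TT)"
  using wk_erase[of p a] by (auto elim: wk.cases intro: wk_Atom)

lemma wk_Bar_iff: "wk p X (Bar R) \<longleftrightarrow> (\<exists>R'. X = Bar R' \<and> wk (\<not> p) R' R)"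
  by (auto elim: wk.cases intro: wk_Bar)

lemma wk_disjs_iff:
  "Rs \<noteq> [] \<Longrightarrow> wk p X (disjs Rs) \<longleftrightarrow> (\<exists>Rs'. X = disjs Rs' \<and> list_all2 (wk p) Rs' Rs)"
proof (cases Rs)
  case (Cons R Rs0)
  have "wk p X (Disj R Rs0)
      \<longleftrightarrow> (\<exists>R' Rs'. X = Disj R' Rs' \<and> wk p R' R \<and> list_all2 (wk p) Rs' Rs0)"
    by (auto elim: wk.cases intro: wk_Disj)
  then show ?thesis
    by (simp add: Cons disjs_def list_all2_Cons2) (metis list.sel(1,3))
qed simp

lemma wk_conjs_iff:
  "Rs \<noteq> [] \<Longrightarrow> wk p X (conjs Rs) \<longleftrightarrow> (\<exists>Rs'. X = conjs Rs' \<and> list_all2 (wk p) Rs' Rs)"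
proof (cases Rs)
  case (Cons R Rs0)
  have "wk p X (Conj R Rs0)
      \<longleftrightarrow> (\<exists>R' Rs'. X = Conj R' Rs' \<and> wk p R' R \<and> list_all2 (wk p) Rs' Rs0)"
    by (auto elim: wk.cases intro: wk_Conj)
  then show ?thesis
    by (simp add: Cons conjs_def list_all2_Cons2) (metis list.sel(1,3))
qed simp

lemma wk_disjsI: "list_all2 (wk p) Rs' Rs \<Longrightarrow> Rs \<noteq> [] \<Longrightarrow> wk p (disjs Rs') (disjs Rs)"
  by (auto simp: wk_disjs_iff)

lemma wk_conjsI: "list_all2 (wk p) Rs' Rs \<Longrightarrow> Rs \<noteq> [] \<Longrightarrow> wk p (conjs Rs') (conjs Rs)"
  by (auto simp: wk_conjs_iff)

lemma wk_disj_iff: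
  "wk p X (disjs [R, T]) \<longleftrightarrow> (\<exists>R' T'. X = disjs [R', T'] \<and> wk p R' R \<and> wk p T' T)"
  by (fastforce simp: wk_disjs_iff list_all2_Cons2)

lemma wk_conj_iff:
  "wk p X (conjs [R, T]) \<longleftrightarrow> (\<exists>R' T'. X = conjs [R', T'] \<and> wk p R' R \<and> wk p T' T)"
  by (fastforce simp: wk_conjs_iff list_all2_Cons2)

lemma wk_refl: "wk p R R"
proof -
  \<comment> \<open>Both polarities are needed in the induction, since \<open>Bar\<close> flips
    \<open>p\<close>.\<close>
  have "\<forall>p. wk p R R"
    by (induction R) (auto intro!: wk.intros list.rel_refl_strong)
  then show ?thesis ..
qed

text \<open>Only atoms are erased, so the path to the hole survives, and without negations on it the
  polarity at the hole is still \<open>p\<close>. The last clause allows the filling to be replaced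
  later by the result of a rule.\<close>

lemma wk_fillD:
  "wk p Y (fill S X) \<Longrightarrow> \<exists>S' X'. Y = fill S' X' \<and> wk p X' X \<and>
     (\<forall>Z' Z. wk p Z' Z \<longrightarrow> wk p (fill S' Z') (fill S Z))"
proof (induction S arbitrary: Y)
  case Hole
  then show ?case by (intro exI[of _ Hole] exI[of _ Y]) simp
next
  case (DisjC Ls S Rs)
  then obtain Ls' W Rs' where Y: "Y = disjs (Ls' @ [W] @ Rs')"
      and *: "list_all2 (wk p) Ls' Ls" "wk p W (fill S X)" "list_all2 (wk p) Rs' Rs"
    by (auto simp: wk_disjs_iff list_all2_append2 list_all2_Cons2)
  obtain S' X' where "W = fill S' X'" "wk p X' X"
      "\<forall>Z' Z. wk p Z' Z \<longrightarrow> wk p (fill S' Z') (fill S Z)"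
    using DisjC.IH[OF *(2)] by blast
  with Y * show ?case
    by (intro exI[of _ "DisjC Ls' S' Rs'"] exI[of _ X'])
       (auto intro!: wk_disjsI list_all2_appendI)
next
  case (ConjC Ls S Rs)
  then obtain Ls' W Rs' where Y: "Y = conjs (Ls' @ [W] @ Rs')"
      and *: "list_all2 (wk p) Ls' Ls" "wk p W (fill S X)" "list_all2 (wk p) Rs' Rs"
    by (auto simp: wk_conjs_iff list_all2_append2 list_all2_Cons2)
  obtain S' X' where "W = fill S' X'" "wk p X' X"
      "\<forall>Z' Z. wk p Z' Z \<longrightarrow> wk p (fill S' Z') (fill S Z)"
    using ConjC.IH[OF *(2)] by blast
  with Y * show ?case
    by (intro exI[of _ "ConjC Ls' S' Rs'"] exI[of _ X'])
       (auto intro!: wk_conjsI list_all2_appendI)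
qed

text \<open>One direction of a simulation: every erasure of \<open>R\<close> is matched, up to
  \<approx>, by an erasure of \<open>T\<close>. It ranges over both polarities to be closed under
  \<open>Bar\<close>.\<close>

definition wk_transfer :: "'v strct \<Rightarrow> 'v strct \<Rightarrow> bool" where
  "wk_transfer R T \<longleftrightarrow> (\<forall>p R'. wk p R' R \<longrightarrow> (\<exists>T'. wk p T' T \<and> R' \<approx> T'))"

lemma wk_transferI:
  "(\<And>p R'. wk p R' R \<Longrightarrow> \<exists>T'. wk p T' T \<and> R' \<approx> T') \<Longrightarrow> wk_transfer R T"
  unfolding wk_transfer_def by blast

lemma wk_transfer_trans: "wk_transfer R T \<Longrightarrow> wk_transfer T U \<Longrightarrow> wk_transfer R U"
  unfolding wk_transfer_def by (meson eq_trans)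

lemma wk_transfer_ctxt: "wk_transfer R T \<Longrightarrow> wk_transfer (fill S R) (fill S T)"
  unfolding wk_transfer_def by (metis wk_fillD eq_ctxt)

lemma wk_transfer_bar: "wk_transfer R T \<Longrightarrow> wk_transfer (Bar R) (Bar T)"
  unfolding wk_transfer_def wk_Bar_iff by (metis eq_bar)

text \<open>Erasure acts member by member and preserves the lengths of lists, so the erased list
  splits at the same places, \<open>Ts'\<close> stays non-empty, and flattening still
  applies.\<close>

lemma wk_transfer_disj_assoc:
  assumes "Ts \<noteq> []"
  shows "wk_transfer (disjs (Rs @ [disjs Ts] @ Us)) (disjs (Rs @ Ts @ Us))"
    and "wk_transfer (disjs (Rs @ Ts @ Us)) (disjs (Rs @ [disjs Ts] @ Us))"
proof -
  have *: "disjs (Rs' @ [disjs Ts'] @ Us') \<approx> disjs (Rs' @ Ts' @ Us')"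
    if "list_all2 (wk p) Ts' Ts" for p Rs' Ts' and Us' :: "'a strct list"
    using that assms by (intro disj_assoc) auto
  show "wk_transfer (disjs (Rs @ [disjs Ts] @ Us)) (disjs (Rs @ Ts @ Us))"
  proof (rule wk_transferI)
    fix p R' assume "wk p R' (disjs (Rs @ [disjs Ts] @ Us))"
    then obtain Rs' Ts' Us' where "R' = disjs (Rs' @ [disjs Ts'] @ Us')"
        "list_all2 (wk p) Rs' Rs" "list_all2 (wk p) Ts' Ts" "list_all2 (wk p) Us' Us"
      using assms by (auto simp: wk_disjs_iff list_all2_append2 list_all2_Cons2)
    then show "\<exists>T'. wk p T' (disjs (Rs @ Ts @ Us)) \<and> R' \<approx> T'"
      using assms *[of p Ts' Rs' Us']
      by (intro exI[of _ "disjs (Rs' @ Ts' @ Us')"])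
         (auto intro!: wk_disjsI list_all2_appendI)
  qed
  show "wk_transfer (disjs (Rs @ Ts @ Us)) (disjs (Rs @ [disjs Ts] @ Us))"
  proof (rule wk_transferI)
    fix p R' assume "wk p R' (disjs (Rs @ Ts @ Us))"
    then obtain Rs' Ts' Us' where "R' = disjs (Rs' @ Ts' @ Us')"
        "list_all2 (wk p) Rs' Rs" "list_all2 (wk p) Ts' Ts" "list_all2 (wk p) Us' Us"
      using assms by (auto simp: wk_disjs_iff list_all2_append2 list_all2_Cons2)
    then show "\<exists>T'. wk p T' (disjs (Rs @ [disjs Ts] @ Us)) \<and> R' \<approx> T'"
      using assms *[of p Ts' Rs' Us', THEN eq_sym]
      by (intro exI[of _ "disjs (Rs' @ [disjs Ts'] @ Us')"])
         (auto intro!: wk_disjsI list_all2_appendI)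
  qed
qed

lemma wk_transfer_conj_assoc:
  assumes "Ts \<noteq> []"
  shows "wk_transfer (conjs (Rs @ [conjs Ts] @ Us)) (conjs (Rs @ Ts @ Us))"
    and "wk_transfer (conjs (Rs @ Ts @ Us)) (conjs (Rs @ [conjs Ts] @ Us))"
proof -
  have *: "conjs (Rs' @ [conjs Ts'] @ Us') \<approx> conjs (Rs' @ Ts' @ Us')"
    if "list_all2 (wk p) Ts' Ts" for p Rs' Ts' and Us' :: "'a strct list"
    using that assms by (intro conj_assoc) auto
  show "wk_transfer (conjs (Rs @ [conjs Ts] @ Us)) (conjs (Rs @ Ts @ Us))"
  proof (rule wk_transferI)
    fix p R' assume "wk p R' (conjs (Rs @ [conjs Ts] @ Us))"
    then obtain Rs' Ts' Us' where "R' = conjs (Rs' @ [conjs Ts'] @ Us')"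
        "list_all2 (wk p) Rs' Rs" "list_all2 (wk p) Ts' Ts" "list_all2 (wk p) Us' Us"
      using assms by (auto simp: wk_conjs_iff list_all2_append2 list_all2_Cons2)
    then show "\<exists>T'. wk p T' (conjs (Rs @ Ts @ Us)) \<and> R' \<approx> T'"
      using assms *[of p Ts' Rs' Us']
      by (intro exI[of _ "conjs (Rs' @ Ts' @ Us')"])
         (auto intro!: wk_conjsI list_all2_appendI)
  qed
  show "wk_transfer (conjs (Rs @ Ts @ Us)) (conjs (Rs @ [conjs Ts] @ Us))"
  proof (rule wk_transferI)
    fix p R' assume "wk p R' (conjs (Rs @ Ts @ Us))"
    then obtain Rs' Ts' Us' where "R' = conjs (Rs' @ Ts' @ Us')"
        "list_all2 (wk p) Rs' Rs" "list_all2 (wk p) Ts' Ts" "list_all2 (wk p) Us' Us"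
      using assms by (auto simp: wk_conjs_iff list_all2_append2 list_all2_Cons2)
    then show "\<exists>T'. wk p T' (conjs (Rs @ [conjs Ts] @ Us)) \<and> R' \<approx> T'"
      using assms *[of p Ts' Rs' Us', THEN eq_sym]
      by (intro exI[of _ "conjs (Rs' @ [conjs Ts'] @ Us')"])
         (auto intro!: wk_conjsI list_all2_appendI)
  qed
qed

lemmas wk_iffs = wk_Atom_iff wk_Bar_iff wk_disj_iff wk_conj_iff

text \<open>Both directions at once, because the equivalence has a symmetry rule.\<close>

lemma str_eq_wk_transfer: "R \<approx> T \<Longrightarrow> wk_transfer R T \<and> wk_transfer T R"
proof (induction rule: str_eq.induct)
  case (eq_refl R)
  show ?case by (auto intro: wk_transferI)
next
  case (eq_sym R T)
  then show ?case by simp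
next
  case (eq_trans R T U)
  then show ?case by (blast intro: wk_transfer_trans)
next
  case (disj_assoc Ts Rs Us)
  then show ?case by (blast intro: wk_transfer_disj_assoc)
next
  case (conj_assoc Ts Rs Us)
  then show ?case by (blast intro: wk_transfer_conj_assoc)
next
  case (eq_ctxt R T S)
  then show ?case by (blast intro: wk_transfer_ctxt)
next
  case (eq_bar R T)
  then show ?case by (blast intro: wk_transfer_bar)
next
  \<comment> \<open>Here the polarity matters: under \<open>Bar\<close> the erased atom is the
    opposite unit, whose negation is the unit that erases \<open>Atom (dual a)\<close>
    outside.\<close>
  case (bar_atom a)
  show ?case
    using str_eq.bar_atom str_eq.bar_ff str_eq.bar_tt
    by (auto intro!: wk_transferI simp: wk_iffs) (blast intro: str_eq.eq_sym)+
next
  \<comment> \<open>In this and the remaining equations each variable occurs once on either side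
    with the same polarity, and a unit is related only to itself; the erased members are simply put
    in their new places.\<close>
  case (disj_comm R T)
  show ?case by (auto intro!: wk_transferI simp: wk_iffs) (blast intro: str_eq.disj_comm)+
next
  case (conj_comm R T)
  show ?case by (auto intro!: wk_transferI simp: wk_iffs) (blast intro: str_eq.conj_comm)+
next
  case conj_ff
  show ?case
    by (auto intro!: wk_transferI simp: wk_iffs)
       (blast intro: str_eq.conj_ff str_eq.eq_sym[OF str_eq.conj_ff])+
next
  case (disj_ff R)
  show ?case
    by (auto intro!: wk_transferI simp: wk_iffs)
       (blast intro: str_eq.disj_ff str_eq.eq_sym[OF str_eq.disj_ff])+
next
  case disj_tt
  show ?case
    by (auto intro!: wk_transferI simp: wk_iffs)
       (blast intro: str_eq.disj_tt str_eq.eq_sym[OF str_eq.disj_tt])+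
next
  case (conj_tt R)
  show ?case
    by (auto intro!: wk_transferI simp: wk_iffs)
       (blast intro: str_eq.conj_tt str_eq.eq_sym[OF str_eq.conj_tt])+
next
  case bar_ff
  show ?case
    by (auto intro!: wk_transferI simp: wk_iffs)
       (blast intro: str_eq.bar_ff str_eq.eq_sym[OF str_eq.bar_ff])+
next
  case bar_tt
  show ?case
    by (auto intro!: wk_transferI simp: wk_iffs)
       (blast intro: str_eq.bar_tt str_eq.eq_sym[OF str_eq.bar_tt])+
next
  case (bar_disj R T)
  show ?case
    by (auto intro!: wk_transferI simp: wk_iffs)
       (blast intro: str_eq.bar_disj str_eq.eq_sym[OF str_eq.bar_disj])+
next
  case (bar_conj R T)
  show ?case
    by (auto intro!: wk_transferI simp: wk_iffs)
       (blast intro: str_eq.bar_conj str_eq.eq_sym[OF str_eq.bar_conj])+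
next
  case (bar_bar R)
  show ?case
    by (auto intro!: wk_transferI simp: wk_iffs)
       (blast intro: str_eq.bar_bar str_eq.eq_sym[OF str_eq.bar_bar])+
qed

lemma wk_eqD: "wk p R' R \<Longrightarrow> R \<approx> T \<Longrightarrow> \<exists>T'. wk p T' T \<and> R' \<approx> T'"
  using str_eq_wk_transfer unfolding wk_transfer_def by blast

text \<open>Restores all erased atoms by weakening. At negative polarity the statement is about the
  negated structures: there \<open>Bar TT\<close> is \<open>FF\<close> and
  \<open>Bar (Atom a)\<close> is the dual atom, so \<open>AwDown\<close> applies again.\<close>

lemma wk_derivable:
  "wk p R' R \<Longrightarrow>
     if p then derivable {AwDown} R' R else derivable {AwDown} (Bar R') (Bar R)"
proof (induction rule: wk.induct)
  case (wk_erase p a)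
  have "derivable {AwDown} (Bar TT) (Bar (Atom a))"
  proof -
    have "Bar TT \<approx> FF" by (rule bar_tt)
    also have "derivable {AwDown} FF (Atom (dual a))"
      by (rule derivable_scheme[OF scheme.intros(5)]) simp
    also have "Atom (dual a) \<approx> Bar (Atom a)" by (rule eq_sym[OF bar_atom])
    finally show ?thesis .
  qed
  then show ?case by (auto intro: derivable_scheme scheme.intros)
next
  case (wk_Disj p R' R Rs' Rs)
  have all: "list_all2 (\<lambda>T' T. if p then derivable {AwDown} T' T
      else derivable {AwDown} (Bar T') (Bar T)) (R' # Rs') (R # Rs)"
    using wk_Disj by (auto elim: list_all2_mono)
  have D: "Disj R' Rs' = disjs (R' # Rs')" "Disj R Rs = disjs (R # Rs)"
    by (simp_all add: disjs_def)
  show ?case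
  proof (cases p)
    case True
    with all show ?thesis unfolding D
      using derivable_disjs[of "{AwDown}" "R' # Rs'" "R # Rs" "[]"] by simp
  next
    case False
    have "Bar (disjs (R' # Rs')) \<approx> conjs (map Bar (R' # Rs'))" by (rule Bar_disjs) simp
    also have "derivable {AwDown} \<dots> (conjs (map Bar (R # Rs)))"
      using all False derivable_conjs[of "{AwDown}" "map Bar (R' # Rs')" "map Bar (R # Rs)" "[]"]
      by (simp add: list_all2_map1 list_all2_map2)
    also have "\<dots> \<approx> Bar (disjs (R # Rs))" by (rule eq_sym[OF Bar_disjs]) simp
    finally show ?thesis using False by (simp add: D)
  qed
next
  case (wk_Conj p R' R Rs' Rs)
  have all: "list_all2 (\<lambda>T' T. if p then derivable {AwDown} T' T
      else derivable {AwDown} (Bar T') (Bar T)) (R' # Rs') (R # Rs)"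
    using wk_Conj by (auto elim: list_all2_mono)
  have D: "Conj R' Rs' = conjs (R' # Rs')" "Conj R Rs = conjs (R # Rs)"
    by (simp_all add: conjs_def)
  show ?case
  proof (cases p)
    case True
    with all show ?thesis unfolding D
      using derivable_conjs[of "{AwDown}" "R' # Rs'" "R # Rs" "[]"] by simp
  next
    case False
    have "Bar (conjs (R' # Rs')) \<approx> disjs (map Bar (R' # Rs'))" by (rule Bar_conjs) simp
    also have "derivable {AwDown} \<dots> (disjs (map Bar (R # Rs)))"
      using all False derivable_disjs[of "{AwDown}" "map Bar (R' # Rs')" "map Bar (R # Rs)" "[]"]
      by (simp add: list_all2_map1 list_all2_map2)
    also have "\<dots> \<approx> Bar (conjs (R # Rs))" by (rule eq_sym[OF Bar_conjs]) simp
    finally show ?thesis using False by (simp add: D)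
  qed
next
  case (wk_Bar p R' R)
  show ?case
  proof (cases p)
    case False
    have "Bar (Bar R') \<approx> R'" by (rule bar_bar)
    also have "derivable {AwDown} R' R" using wk_Bar False by simp
    also have "R \<approx> Bar (Bar R)" by (rule eq_sym[OF bar_bar])
    finally show ?thesis using False by simp
  qed (use wk_Bar in simp)
qed (auto intro: derivable_eq)

section \<open>Permuting weakening downwards\<close>

text \<open>A switch on units only: \<open>FF\<close> is ([f,t],f), and switching gives [(f,f),t],
  which is \<open>TT\<close>.\<close>

lemma derivable_FF_TT:
  assumes "Switch \<in> \<S>"
  shows "derivable \<S> FF TT"
proof -
  have "FF \<approx> conjs [disjs [FF, TT], FF]"
    by (rule eq_sym[OF eq_trans[OF conj_cong[OF disj_ff eq_refl] conj_tt]])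
  also have "derivable \<S> \<dots> (disjs [conjs [FF, FF], TT])"
    using assms by (intro derivable_scheme[OF scheme.intros(3)])
  also have "\<dots> \<approx> TT"
    by (rule eq_trans[OF disj_cong[OF conj_ff eq_refl] disj_ff])
  finally show ?thesis .
qed

text \<open>\<open>FF\<close> is ((t,f),f). The inner t is expanded to a dual pair, and two switches
  attach one of the two copies of f to each atom of the pair.\<close>

lemma derivable_FF_dual_pair:
  assumes "AiDown \<in> \<S>" "Switch \<in> \<S>"
  shows "derivable \<S> FF (disjs [conjs [FF, Atom b], conjs [Bar (Atom b), FF]])"
proof -
  let ?b = "Atom b" and ?c = "Bar (Atom b)"
  have "FF \<approx> conjs [conjs [TT, FF], FF]"
    by (rule eq_sym[OF eq_trans[OF conj_cong[OF conj_tt eq_refl] conj_ff]])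
  also have "derivable \<S> \<dots> (conjs [conjs [disjs [?b, ?c], FF], FF])"
    using assms by (intro derivable_conj derivable_scheme[OF scheme.intros(1)] derivable_eq) auto
  also have "derivable \<S> \<dots> (conjs [disjs [conjs [?b, FF], ?c], FF])"
    using assms by (intro derivable_conj derivable_scheme[OF scheme.intros(3)] derivable_eq) auto
  \<comment> \<open>Switch attaches the conjunct to the first disjunct, so \<open>?c\<close> is
    moved to the front to receive the second f.\<close>
  also have "\<dots> \<approx> conjs [disjs [?c, conjs [FF, ?b]], FF]"
    by (intro conj_cong eq_trans[OF disj_comm disj_cong] conj_comm eq_refl)
  also have "derivable \<S> \<dots> (disjs [conjs [?c, FF], conjs [FF, ?b]])"
    using assms by (intro derivable_scheme[OF scheme.intros(3)])
  also have "\<dots> \<approx> disjs [conjs [FF, ?b], conjs [?c, FF]]" by (rule disj_comm)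
  finally show ?thesis .
qed

text \<open>The atom is consumed by interaction and contraction instead of weakening, so the lemma
  is still available once \<open>AwUp\<close> has been removed from the system.\<close>

lemma derivable_conj_FF_Atom:
  assumes "{AiDown, AiUp, Switch, Medial, AcDown} \<subseteq> \<S>"
  shows "derivable \<S> (conjs [FF, Atom b]) FF"
proof -
  let ?b = "Atom b" and ?c = "Bar (Atom b)"
  let ?fb = "conjs [FF, ?b]" and ?cf = "conjs [?c, FF]"
  have "derivable \<S> (disjs [?fb, ?fb]) (conjs [disjs [FF, FF], disjs [?b, ?b]])"
    using assms by (intro derivable_scheme[OF scheme.intros(4)]) simp
  also have "derivable \<S> \<dots> (conjs [FF, ?b])"
    using assms by (intro derivable_conj derivable_eq[OF disj_ff]
        derivable_scheme[OF scheme.intros(7)]) simp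
  finally have merge: "derivable \<S> (disjs [?fb, ?fb]) ?fb" .
  \<comment> \<open>The added unit is the seed from which the second (f,b) and its partner (c,f)
    grow.\<close>
  have "?fb \<approx> disjs [?fb, FF]" by (rule eq_sym[OF disj_ff_right])
  also have "derivable \<S> \<dots> (disjs [?fb, disjs [?fb, ?cf]])"
    using assms by (intro derivable_disj derivable_eq[OF eq_refl] derivable_FF_dual_pair) auto
  also have "\<dots> \<approx> disjs [disjs [?fb, ?fb], ?cf]" by (rule eq_sym[OF disj_assoc2])
  also have "derivable \<S> \<dots> (disjs [?fb, ?cf])"
    by (intro derivable_disj merge derivable_eq[OF eq_refl])
  \<comment> \<open>Medial pairs crosswise, so each atom sits in a disjunction with f; the units
    vanish and \<open>?b\<close> meets its dual in a conjunction.\<close>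
  also have "derivable \<S> \<dots> (conjs [disjs [FF, ?c], disjs [?b, FF]])"
    using assms by (intro derivable_scheme[OF scheme.intros(4)]) simp
  also have "\<dots> \<approx> conjs [?b, ?c]"
    by (rule eq_trans[OF conj_cong[OF disj_ff disj_ff_right] conj_comm])
  also have "derivable \<S> \<dots> FF"
    using assms by (intro derivable_scheme[OF scheme.intros(2)]) simp
  finally show ?thesis .
qed

text \<open>Case analysis on the rule: atoms missing above are either missing below too, or their
  absence is repaired by a derivation without \<open>AwDown\<close>.\<close>

lemma scheme_wk:
  assumes "scheme r X Y" "r \<in> \<S>" "SKS - {AwDown, AwUp} \<subseteq> \<S>" "wk True X' X"
  shows "\<exists>Y'. wk True Y' Y \<and> derivable (\<S> - {AwDown}) X' Y'"
proof -
  let ?S = "\<S> - {AwDown}"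
  have core: "{AiDown, AiUp, Switch, Medial, AcDown, AcUp} \<subseteq> ?S"
    using assms(3) by (auto simp: SKS_def)
  from assms(1,2,4) show ?thesis
  proof (induction rule: scheme.induct)
    case (1 a)
    then show ?case using core wk_refl by (auto intro!: derivable_scheme[OF scheme.intros(1)])
  next
    \<comment> \<open>Four cases by which of the two atoms are erased; the one under
      \<open>Bar\<close> is erased to \<open>TT\<close>. Exactly one erasure leaves an atom to be
      consumed next to f.\<close>
    case (2 a)
    have ff: "derivable ?S (conjs [FF, Bar (Atom a)]) FF"
    proof -
      have "conjs [FF, Bar (Atom a)] \<approx> conjs [FF, Atom (dual a)]"
        by (intro conj_cong bar_atom eq_refl)
      also have "derivable ?S \<dots> FF" using core by (intro derivable_conj_FF_Atom) auto
      finally show ?thesis .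
    qed
    have "derivable ?S (conjs [Atom a, Bar TT]) FF"
    proof -
      have "conjs [Atom a, Bar TT] \<approx> conjs [FF, Atom a]"
        by (rule eq_trans[OF conj_cong[OF eq_refl bar_tt] conj_comm])
      also have "derivable ?S \<dots> FF" using core by (intro derivable_conj_FF_Atom) auto
      finally show ?thesis .
    qed
    moreover have "derivable ?S (conjs [FF, Bar TT]) FF"
      by (rule derivable_eq[OF eq_trans[OF conj_cong[OF eq_refl bar_tt] conj_ff]])
    moreover have "derivable ?S (conjs [Atom a, Bar (Atom a)]) FF"
      using core by (intro derivable_scheme[OF scheme.intros(2)]) simp
    ultimately show ?case using 2 ff by (auto simp: wk_iffs)
  next
    case (3 R U T)
    then show ?case
      using core by (fastforce simp: wk_iffs intro: derivable_scheme[OF scheme.intros(3)])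
  next
    case (4 R U T V)
    then show ?case
      using core by (fastforce simp: wk_iffs intro: derivable_scheme[OF scheme.intros(4)])
  next
    \<comment> \<open>The instance disappears: with \<open>FF\<close> as \<open>Y'\<close>, the atom
      it would introduce counts as erased.\<close>
    case (5 a)
    then show ?case by (auto simp: wk_iffs intro: derivable_eq)
  next
    \<comment> \<open>A surviving atom is weakened by \<open>AwUp\<close> itself, which lies in the
      system because \<open>r\<close> does.\<close>
    case (6 a)
    then show ?case
      using core derivable_FF_TT[of ?S]
      by (auto simp: wk_iffs intro: derivable_scheme[OF scheme.intros(6)])
  next
    \<comment> \<open>With one atom erased the unit law replaces contraction; with both erased, so
      is the atom in the conclusion.\<close>
    case (7 a)
    then show ?case
      using core
      by (auto simp: wk_iffs ex_disj_distrib conj_disj_distribR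
          intro: derivable_scheme[OF scheme.intros(7)] derivable_eq disj_ff disj_ff_right)
  next
    case (8 a)
    have "derivable ?S FF (conjs [FF, FF])" by (rule derivable_eq[OF eq_sym[OF conj_ff]])
    moreover have "derivable ?S (Atom a) (conjs [Atom a, Atom a])"
      using core by (intro derivable_scheme[OF scheme.intros(8)]) simp
    ultimately show ?case using 8 by (fastforce simp: wk_iffs)
  qed
qed

text \<open>The erasure is carried through the equivalence above, the context, the scheme and the
  equivalence below, in this order.\<close>

lemma rule_instance_wk:
  assumes "rule_instance r P Q" "r \<in> \<S>" "SKS - {AwDown, AwUp} \<subseteq> \<S>" "wk True P' P"
  shows "\<exists>Q'. wk True Q' Q \<and> derivable (\<S> - {AwDown}) P' Q'"
proof -
  obtain S X Y where *: "scheme r X Y" "P \<approx> fill S X" "Q \<approx> fill S Y"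
    using assms(1) unfolding rule_instance_def by blast
  obtain S' X' where P': "P' \<approx> fill S' X'" and X': "wk True X' X"
      and S': "\<And>Z' Z. wk True Z' Z \<Longrightarrow> wk True (fill S' Z') (fill S Z)"
    using wk_eqD[OF assms(4) *(2)] wk_fillD[of True _ S X] by blast
  obtain Y' where Y': "wk True Y' Y" and der: "derivable (\<S> - {AwDown}) X' Y'"
    using scheme_wk[OF *(1) assms(2,3) X'] by blast
  obtain Q' where Q': "wk True Q' Q" "fill S' Y' \<approx> Q'"
    using wk_eqD[OF S'[OF Y'] eq_sym[OF *(3)]] by blast
  have "P' \<approx> fill S' X'" by (rule P')
  also have "derivable (\<S> - {AwDown}) \<dots> (fill S' Y')" by (rule derivable_ctxt[OF der])
  also have "\<dots> \<approx> Q'" by (rule Q')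
  finally show ?thesis using Q'(1) by blast
qed

text \<open>Induction from top to bottom for arbitrary \<open>T'\<close>: the erasure is handed from
  each structure to the next, accumulating the weakenings met so far.\<close>

lemma derivation_wk:
  "derivation \<S> T D R \<Longrightarrow> SKS - {AwDown, AwUp} \<subseteq> \<S> \<Longrightarrow> wk True T' T \<Longrightarrow>
     \<exists>R'. wk True R' R \<and> derivable (\<S> - {AwDown}) T' R'"
proof (induction \<S> T D R arbitrary: T' rule: derivation.induct)
  case (1 \<S> T R)
  then show ?case using wk_eqD derivable_eq by fastforce
next
  case (2 \<S> T r Q D R)
  then obtain Q' where "wk True Q' Q" "derivable (\<S> - {AwDown}) T' Q'"
    using rule_instance_wk[of r T Q \<S> T'] by auto
  with 2 show ?case by simp (blast intro: derivable_trans)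
qed

text \<open>Start with nothing erased at the top and restore at the bottom what is then missing. The
  system is left general because the lemma is applied to \<open>SKS\<close> and then to
  \<open>SKS - {AwUp}\<close>.\<close>

lemma separate_AwDown:
  assumes "derivable \<S> T R" "SKS - {AwDown, AwUp} \<subseteq> \<S>"
  obtains U where "derivable (\<S> - {AwDown}) T U" "derivable {AwDown} U R"
  using assms derivation_wk[OF _ _ wk_refl] wk_derivable[of True]
  unfolding derivable_def by (metis (full_types))

theorem theorem3p36:
  fixes T R :: "'v strct" and D :: "(rule \<times> 'v strct) list"
  assumes "derivation SKS T D R"
  shows "\<exists>V U D1 D2 D3.
           derivation {AwUp} T D1 V \<and>
           derivation (SKS - {AwDown, AwUp}) V D2 U \<and>
           derivation {AwDown} U D3 R \<and>
           derivation SKS T (D1 @ D2 @ D3) R"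
proof -
  have "derivable SKS T R" using assms unfolding derivable_def by blast
  then obtain U where TU: "derivable (SKS - {AwDown}) T U" and UR: "derivable {AwDown} U R"
    by (rule separate_AwDown) auto
  \<comment> \<open>Negation turns the upper part over, so its instances of \<open>AwUp\<close>
    become instances of \<open>AwDown\<close>, which a second separation moves to the
    bottom.\<close>
  have "dual_rule ` (SKS - {AwDown}) = SKS - {AwUp}" by (auto simp: SKS_def insert_Diff_if)
  then have "derivable (SKS - {AwUp}) (Bar U) (Bar T)" using derivable_dual[OF TU] by simp
  then obtain W where UW: "derivable (SKS - {AwUp} - {AwDown}) (Bar U) W"
      and WT: "derivable {AwDown} W (Bar T)"
    by (rule separate_AwDown) auto
  \<comment> \<open>Turning back puts the separated weakenings on top as \<open>AwUp\<close>; the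
    structure \<open>V\<close> is \<open>Bar W\<close>.\<close>
  have "T \<approx> Bar (Bar T)" by (rule eq_sym[OF bar_bar])
  also have "derivable {AwUp} \<dots> (Bar W)" using derivable_dual[OF WT] by simp
  finally obtain D1 where D1: "derivation {AwUp} T D1 (Bar W)" unfolding derivable_def by blast
  have "dual_rule ` (SKS - {AwUp} - {AwDown}) = SKS - {AwDown, AwUp}"
    by (auto simp: SKS_def insert_Diff_if)
  then have "derivable (SKS - {AwDown, AwUp}) (Bar W) (Bar (Bar U))"
    using derivable_dual[OF UW] by simp
  also have "Bar (Bar U) \<approx> U" by (rule bar_bar)
  finally obtain D2 where D2: "derivation (SKS - {AwDown, AwUp}) (Bar W) D2 U"
    unfolding derivable_def by blast
  obtain D3 where D3: "derivation {AwDown} U D3 R" using UR unfolding derivable_def by blast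
  have "derivation SKS T (D1 @ D2 @ D3) R"
    by (rule derivation_append[OF _ derivation_append])
       (rule derivation_mono[OF D1] derivation_mono[OF D2] derivation_mono[OF D3],
         auto simp: SKS_def)+
  with D1 D2 D3 show ?thesis by blast
qed

end
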